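(* Let $\mathcal Z$ be a commutative associative unital $\mathbb Q$-algebra, $N\in\mathbb N$, $n\in[N]$, $Z=(z_{j,r})\in\mathcal Z^{N\times n}$. Let $R,S\subseteq[n]$ and $r\in[n]\setminus(R\cup S)$ (so this set is nonempty). Then $$\overline p_{R\cup\{r\}}\overline p_S-\overline p_R\overline p_{S\cup\{r\}}=\frac12\sum_{s\in[n]\setminus\{r\}}\ \sum_{(u,v)\in[N]^2_{\neq}}y_{u,v,r}\,y_{u,v,s}\sum_{\substack{j\in[N]^n_{\neq}\\ j_r=u,\,j_s=v}}\ \sum_{\substack{k\in[N]^n_{\neq}\\ k_r=u}}\big(\mathbb 1_S(s)\,p_{j,S\setminus\{s\}}\,p_{k,R}-\mathbb 1_R(s)\,p_{j,R\setminus\{s\}}\,p_{k,S}\big),$$ where for $n=1$ the right-hand side is defined to be zero.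
   Context: $[m]=\{1,\dots,m\}$. $[N]^n_{\neq}$ is the set of injective maps $j:[n]\to[N]$, written $j=(j_1,\dots,j_n)$; $[N]^2_{\neq}=\{(u,v):u\ne v\}$. For $j,k\in[N]$ and $r\in[n]$, $y_{j,k,r}=z_{j,r}-z_{k,r}$. For $R\subseteq[n]$ and an injective map $j$ from a set containing $R$ into $[N]$, $p_{j,R}=\prod_{\ell\in R}z_{j_\ell,\ell}$. For $R\subseteq[n]$, $\overline p_R=\sum_{j\in[N]^n_{\neq}}p_{j,R}$. $\mathbb 1_A$ is the indicator function of $A$. Empty sums are $0$, empty products are $1$. *)

theory Defs
  imports Complex_Main "HOL-Library.FuncSet" "HOL-Library.Indicator_Function"
begin

text \<open>
  The sort \<open>{comm_ring, comm_monoid_mult}\<close> is that of commutative associative unital rings in which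
  \<open>0 = 1\<close> is allowed; \<open>comm_ring_1\<close> would exclude the zero algebra.
\<close>

locale comm_rat_algebra = vector_space scale
  for scale :: "rat \<Rightarrow> 'a::{comm_ring, comm_monoid_mult} \<Rightarrow> 'a" +
  assumes scale_mult_left: "scale c x * y = scale c (x * y)"

text \<open>
  The set \<open>[N]\<^sup>n\<^sub>\<noteq>\<close> of injective maps from \<open>{1..n}\<close> to \<open>{1..N}\<close>. Each map is represented by exactly one
  (extensional) function on \<open>nat\<close>, so that sums over this set count every map once.
\<close>

definition inj_tuples :: "nat \<Rightarrow> nat \<Rightarrow> (nat \<Rightarrow> nat) set" where
  "inj_tuples N n = {j \<in> {1..n} \<rightarrow>\<^sub>E {1..N}. inj_on j {1..n}}"

definition distinct_pairs :: "nat \<Rightarrow> (nat \<times> nat) set" where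
  "distinct_pairs N = {(u, v) \<in> {1..N} \<times> {1..N}. u \<noteq> v}"

definition ydiff :: "(nat \<Rightarrow> nat \<Rightarrow> 'a::comm_ring) \<Rightarrow> nat \<Rightarrow> nat \<Rightarrow> nat \<Rightarrow> 'a" where
  "ydiff z j k r = z j r - z k r"

definition pprod :: "(nat \<Rightarrow> nat \<Rightarrow> 'a::comm_monoid_mult) \<Rightarrow> (nat \<Rightarrow> nat) \<Rightarrow> nat set \<Rightarrow> 'a" where
  "pprod z j R = (\<Prod>l\<in>R. z (j l) l)"

definition pbar ::
  "nat \<Rightarrow> nat \<Rightarrow> (nat \<Rightarrow> nat \<Rightarrow> 'a::{comm_ring, comm_monoid_mult}) \<Rightarrow> nat set \<Rightarrow> 'a" where
  "pbar N n z R = (\<Sum>j\<in>inj_tuples N n. pprod z j R)"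

end

theory Submission
  imports Defs "HOL-Combinatorics.Transposition"
begin

text \<open>
  Split the sums \<open>pbar\<close> according to the value \<open>u\<close> of the tuple at \<open>r\<close>, with fibre sums \<open>K\<^sub>R(u)\<close>.
  The left-hand side is the sum of \<open>(z\<^sub>u - z\<^sub>v) K\<^sub>R(u) K\<^sub>S(v)\<close> over all \<open>u, v\<close>, where
  \<open>z\<^sub>u\<close> stands for \<open>z u r\<close>; symmetrizing in \<open>u, v\<close>
  gives half the sum of \<open>(z\<^sub>u - z\<^sub>v) (K\<^sub>R(u) (K\<^sub>S(v) - K\<^sub>S(u)) - K\<^sub>S(u) (K\<^sub>R(v) - K\<^sub>R(u)))\<close>.
  Composing a tuple with the transposition of \<open>u\<close> and \<open>v\<close> exchanges the fibres over \<open>u\<close> and \<open>v\<close> and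
  changes at most the one factor indexed by the \<open>s\<close> with \<open>j s = v\<close>, which evaluates \<open>K\<^sub>S(v) - K\<^sub>S(u)\<close>.
\<close>

definition fibre_sum ::
  "nat \<Rightarrow> nat \<Rightarrow> (nat \<Rightarrow> nat \<Rightarrow> 'a::{comm_ring, comm_monoid_mult}) \<Rightarrow> nat \<Rightarrow> nat set \<Rightarrow> nat \<Rightarrow> 'a" where
  "fibre_sum N n z r S u = (\<Sum>j\<in>{j \<in> inj_tuples N n. j r = u}. pprod z j S)"

text \<open>Used with \<open>S - {s}\<close> in place of \<open>S\<close>: the factor at
  \<open>s\<close> is pulled out, since its value is fixed by \<open>j s = v\<close>.\<close>

definition fibre_sum2 ::
  "nat \<Rightarrow> nat \<Rightarrow> (nat \<Rightarrow> nat \<Rightarrow> 'a::{comm_ring, comm_monoid_mult}) \<Rightarrow> nat \<Rightarrow> nat \<Rightarrow> nat set \<Rightarrow>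
    nat \<Rightarrow> nat \<Rightarrow> 'a" where
  "fibre_sum2 N n z r s S u v = (\<Sum>j\<in>{j \<in> inj_tuples N n. j r = u \<and> j s = v}. pprod z j S)"

lemma finite_inj_tuples [simp]: "finite (inj_tuples N n)"
proof -
  have "finite ({1..n} \<rightarrow>\<^sub>E {1..N})"
    by (intro finite_PiE) auto
  then show ?thesis
    unfolding inj_tuples_def by simp
qed

lemma inj_tuples_mem: "j \<in> inj_tuples N n \<Longrightarrow> l \<in> {1..n} \<Longrightarrow> j l \<in> {1..N}"
  unfolding inj_tuples_def by auto

lemma sum_over_fibres:
  fixes f :: "(nat \<Rightarrow> nat) \<Rightarrow> 'a::comm_monoid_add"
  assumes "r \<in> {1..n}"
  shows "(\<Sum>u\<in>{1..N}. \<Sum>j\<in>{j \<in> inj_tuples N n. j r = u}. f j) = (\<Sum>j\<in>inj_tuples N n. f j)"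
  using inj_tuples_mem[OF _ assms] by (intro sum.group) auto

lemma pbar_eq_sum_fibre_sum:
  assumes "r \<in> {1..n}"
  shows "pbar N n z S = (\<Sum>u\<in>{1..N}. fibre_sum N n z r S u)"
  unfolding pbar_def fibre_sum_def sum_over_fibres[OF assms] ..

text \<open>The extra factor \<open>z (j r) r\<close> is constant on each fibre, so it comes out of
  the fibre sum.\<close>

lemma pbar_insert_eq_sum_fibre_sum:
  assumes "r \<in> {1..n}" "r \<notin> S" "finite S"
  shows "pbar N n z (S \<union> {r}) = (\<Sum>u\<in>{1..N}. z u r * fibre_sum N n z r S u)"
proof -
  have "pbar N n z (S \<union> {r}) =
      (\<Sum>u\<in>{1..N}. \<Sum>j\<in>{j \<in> inj_tuples N n. j r = u}. pprod z j (S \<union> {r}))"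
    unfolding pbar_def sum_over_fibres[OF assms(1)] ..
  also have "\<dots> = (\<Sum>u\<in>{1..N}. z u r * fibre_sum N n z r S u)"
    unfolding fibre_sum_def sum_distrib_left
    using assms by (intro sum.cong) (auto simp: pprod_def)
  finally show ?thesis .
qed

text \<open>The restriction to \<open>{1..n}\<close> keeps the composed map extensional, hence
  inside \<open>inj_tuples\<close>.\<close>

definition swap_tuple :: "nat \<Rightarrow> nat \<Rightarrow> nat \<Rightarrow> (nat \<Rightarrow> nat) \<Rightarrow> nat \<Rightarrow> nat" where
  "swap_tuple n u v j = (\<lambda>l\<in>{1..n}. transpose u v (j l))"

lemma swap_tuple_in_inj_tuples:
  assumes "j \<in> inj_tuples N n" "u \<in> {1..N}" "v \<in> {1..N}"
  shows "swap_tuple n u v j \<in> inj_tuples N n"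
proof -
  have "transpose u v (j l) \<in> {1..N}" if "l \<in> {1..n}" for l
    using inj_tuples_mem[OF assms(1) that] assms(2,3) unfolding transpose_def by simp
  moreover have "inj_on (\<lambda>l. transpose u v (j l)) {1..n}"
    using assms(1) by (auto simp: inj_tuples_def intro!: inj_onI dest!: injD[OF inj_transpose] dest: inj_onD)
  ultimately show ?thesis
    unfolding inj_tuples_def swap_tuple_def
    by (simp only: mem_Collect_eq restrict_PiE_iff inj_on_restrict_eq) blast
qed

lemma swap_tuple_swap_tuple:
  assumes "j \<in> inj_tuples N n"
  shows "swap_tuple n v u (swap_tuple n u v j) = j"
proof
  fix l
  show "swap_tuple n v u (swap_tuple n u v j) l = j l"
    using assms unfolding inj_tuples_def swap_tuple_def
    by (cases "l \<in> {1..n}") (auto simp: PiE_def extensional_def transpose_commute[of v u])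
qed

text \<open>By injectivity, \<open>j\<close> takes the value \<open>u\<close> only at
  \<open>r\<close>, outside \<open>S\<close>, and \<open>v\<close> at no more than one place, so at
  most one summand is nonzero. The form as a sum over \<open>S\<close> allows exchanging it with the
  sum over \<open>j\<close> later.\<close>

lemma pprod_swap_tuple_diff:
  fixes z :: "nat \<Rightarrow> nat \<Rightarrow> 'a::{comm_ring, comm_monoid_mult}"
  assumes j: "j \<in> inj_tuples N n" "j r = u"
    and r: "r \<in> {1..n}" and S: "S \<subseteq> {1..n}" "r \<notin> S"
  shows "pprod z (swap_tuple n u v j) S - pprod z j S =
    (\<Sum>s\<in>S. if j s = v then ydiff z u v s * pprod z j (S - {s}) else 0)"
proof -
  have fin: "finite S"
    using S(1) finite_subset by blast
  have inj: "inj_on j {1..n}"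
    using j(1) by (simp add: inj_tuples_def)
  have ne_u: "j l \<noteq> u" if "l \<in> S" for l
    using inj j(2) r S that by (metis inj_onD subsetD)
  have fix_l: "swap_tuple n u v j l = j l" if "l \<in> S" "j l \<noteq> v" for l
    using that ne_u S(1) unfolding swap_tuple_def by auto
  show ?thesis
  proof (cases "\<exists>s\<in>S. j s = v")
    case True
    then obtain s where s: "s \<in> S" "j s = v"
      by blast
    have only_s: "j l = v \<longleftrightarrow> l = s" if "l \<in> S" for l
      using inj s S(1) that by (metis inj_onD subsetD)
    have split: "pprod z i S = z (i s) s * pprod z i (S - {s})" for i
      unfolding pprod_def using fin s(1) by (rule prod.remove)
    have "pprod z (swap_tuple n u v j) (S - {s}) = pprod z j (S - {s})"
      unfolding pprod_def using fix_l only_s by (intro prod.cong) auto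
    moreover have "swap_tuple n u v j s = u"
      using s S(1) unfolding swap_tuple_def by auto
    ultimately have "pprod z (swap_tuple n u v j) S - pprod z j S =
        ydiff z u v s * pprod z j (S - {s})"
      unfolding split[of j] split[of "swap_tuple n u v j"] ydiff_def using s(2)
      by (simp add: left_diff_distrib)
    also have "\<dots> = (\<Sum>l\<in>S. if l = s then ydiff z u v l * pprod z j (S - {l}) else 0)"
      using fin s(1) by simp
    also have "\<dots> = (\<Sum>l\<in>S. if j l = v then ydiff z u v l * pprod z j (S - {l}) else 0)"
      using only_s by (intro sum.cong) auto
    finally show ?thesis .
  next
    case False
    then have "pprod z (swap_tuple n u v j) S = pprod z j S"
      unfolding pprod_def using fix_l by (intro prod.cong) auto
    with False show ?thesis
      by simp
  qed
qed

text \<open>Reindexing by the transposition brings both sums onto the fibre over \<open>u\<close>,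
  where they are subtracted termwise; the condition \<open>j s = v\<close> then cuts out the
  two-point fibres.\<close>

lemma fibre_sum_diff:
  fixes z :: "nat \<Rightarrow> nat \<Rightarrow> 'a::{comm_ring, comm_monoid_mult}"
  assumes r: "r \<in> {1..n}" and S: "S \<subseteq> {1..n}" "r \<notin> S"
    and uv: "u \<in> {1..N}" "v \<in> {1..N}"
  shows "fibre_sum N n z r S v - fibre_sum N n z r S u =
    (\<Sum>s\<in>S. ydiff z u v s * fibre_sum2 N n z r s (S - {s}) u v)"
proof -
  let ?F = "\<lambda>u. {j \<in> inj_tuples N n. j r = u}"
  have "fibre_sum N n z r S v = (\<Sum>j\<in>?F u. pprod z (swap_tuple n u v j) S)"
    unfolding fibre_sum_def
    using r uv
    by (intro sum.reindex_bij_witness[of _ "swap_tuple n u v" "swap_tuple n v u"])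
      (auto simp: swap_tuple_swap_tuple swap_tuple_in_inj_tuples, auto simp: swap_tuple_def)
  then have "fibre_sum N n z r S v - fibre_sum N n z r S u =
      (\<Sum>j\<in>?F u. pprod z (swap_tuple n u v j) S - pprod z j S)"
    by (simp add: fibre_sum_def sum_subtractf)
  also have "\<dots> = (\<Sum>j\<in>?F u. \<Sum>s\<in>S.
      if j s = v then ydiff z u v s * pprod z j (S - {s}) else 0)"
    using r S by (intro sum.cong refl pprod_swap_tuple_diff) auto
  also have "\<dots> = (\<Sum>s\<in>S. \<Sum>j\<in>?F u.
      if j s = v then ydiff z u v s * pprod z j (S - {s}) else 0)"
    by (rule sum.swap)
  also have "\<dots> = (\<Sum>s\<in>S. \<Sum>j\<in>{j \<in> ?F u. j s = v}. ydiff z u v s * pprod z j (S - {s}))"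
    by (intro sum.cong refl sum.inter_filter[symmetric]) simp
  also have "\<dots> = (\<Sum>s\<in>S. ydiff z u v s * fibre_sum2 N n z r s (S - {s}) u v)"
    unfolding fibre_sum2_def sum_distrib_left by simp
  finally show ?thesis .
qed

lemma sum_distinct_pairs:
  fixes f :: "nat \<Rightarrow> nat \<Rightarrow> 'a::comm_monoid_add"
  assumes "\<And>u. f u u = 0"
  shows "(\<Sum>(u, v)\<in>distinct_pairs N. f u v) = (\<Sum>u\<in>{1..N}. \<Sum>v\<in>{1..N}. f u v)"
proof -
  have "(\<Sum>(u, v)\<in>distinct_pairs N. f u v) = (\<Sum>(u, v)\<in>{1..N} \<times> {1..N}. f u v)"
    using assms by (intro sum.mono_neutral_left) (auto simp: distinct_pairs_def)
  then show ?thesis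
    by (simp add: sum.cartesian_product)
qed

text \<open>Expanding gives four products of sums, equal in pairs by commutativity. The result is
  \<open>d + d\<close> because \<open>comm_ring\<close> has no unit and so no numeral 2.\<close>

lemma sum_antisymmetrized:
  fixes x a b :: "'i \<Rightarrow> 'a::comm_ring"
  shows "(\<Sum>u\<in>I. \<Sum>v\<in>I. (x u - x v) * (a u * b v - b u * a v)) =
    (let d = (\<Sum>u\<in>I. x u * a u) * sum b I - sum a I * (\<Sum>u\<in>I. x u * b u) in d + d)"
proof -
  have "(\<Sum>u\<in>I. \<Sum>v\<in>I. (x u - x v) * (a u * b v - b u * a v)) =
      (\<Sum>u\<in>I. \<Sum>v\<in>I. (x u * a u) * b v) - (\<Sum>u\<in>I. \<Sum>v\<in>I. (x u * b u) * a v)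
      - (\<Sum>u\<in>I. \<Sum>v\<in>I. a u * (x v * b v)) + (\<Sum>u\<in>I. \<Sum>v\<in>I. b u * (x v * a v))"
    unfolding sum_subtractf[symmetric] sum.distrib[symmetric]
    by (intro sum.cong refl) (simp add: algebra_simps)
  then show ?thesis
    unfolding sum_product[symmetric] Let_def by (simp add: algebra_simps)
qed

theorem theorem3p3:
  fixes scale :: "rat \<Rightarrow> 'a::{comm_ring, comm_monoid_mult} \<Rightarrow> 'a" (infixr "*\<^sub>Q" 75)
    and z :: "nat \<Rightarrow> nat \<Rightarrow> 'a"
    and N n r :: nat
    and R S :: "nat set"
  assumes "comm_rat_algebra scale"
    and "n \<in> {1..N}"
    and "R \<subseteq> {1..n}" and "S \<subseteq> {1..n}"
    and "r \<in> {1..n} - (R \<union> S)"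
  shows "pbar N n z (R \<union> {r}) * pbar N n z S - pbar N n z R * pbar N n z (S \<union> {r}) =
    (1/2) *\<^sub>Q (\<Sum>s\<in>{1..n} - {r}. \<Sum>(u, v)\<in>distinct_pairs N.
      ydiff z u v r * ydiff z u v s *
      (\<Sum>j\<in>{j \<in> inj_tuples N n. j r = u \<and> j s = v}. \<Sum>k\<in>{k \<in> inj_tuples N n. k r = u}.
        indicator S s *\<^sub>Q (pprod z j (S - {s}) * pprod z k R)
        - indicator R s *\<^sub>Q (pprod z j (R - {s}) * pprod z k S)))"
proof -
  interpret comm_rat_algebra scale
    by fact
  have r: "r \<in> {1..n}" "r \<notin> R" "r \<notin> S"
    using assms(5) by auto
  have fin: "finite R" "finite S"
    using assms(3,4) finite_subset by blast+
  let ?K = "fibre_sum N n z r"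
  let ?J = "\<lambda>s A. fibre_sum2 N n z r s (A - {s})"
  let ?D = "pbar N n z (R \<union> {r}) * pbar N n z S - pbar N n z R * pbar N n z (S \<union> {r})"
  let ?T = "\<lambda>s u v. \<Sum>j\<in>{j \<in> inj_tuples N n. j r = u \<and> j s = v}.
      \<Sum>k\<in>{k \<in> inj_tuples N n. k r = u}.
        indicator S s *\<^sub>Q (pprod z j (S - {s}) * pprod z k R)
        - indicator R s *\<^sub>Q (pprod z j (R - {s}) * pprod z k S)"
  \<comment> \<open>Here \<open>A\<close> is the set that loses \<open>s\<close> in the sum over
    \<open>j\<close>, and \<open>B\<close> is the set in the sum over \<open>k\<close>.\<close>
  let ?t = "\<lambda>A B s u v. ydiff z u v s * ?J s A u v * ?K B u"
  have indicator: "indicator A s *\<^sub>Q x = (if s \<in> A then x else 0)" for A :: "nat set" and s x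
    by simp
  \<comment> \<open>Each summand is a function of \<open>j\<close> times a function of
    \<open>k\<close>, so the double sum factors.\<close>
  have T: "ydiff z u v s * ?T s u v =
      (if s \<in> S then ?t S R s u v else 0) - (if s \<in> R then ?t R S s u v else 0)" for s u v
    unfolding indicator sum_subtractf fibre_sum_def fibre_sum2_def
    by (auto simp: sum_product[symmetric] right_diff_distrib mult.assoc)
  have restrict: "(\<Sum>s\<in>{1..n} - {r}. if s \<in> A then f s else 0) = sum f A"
    if "A \<subseteq> {1..n}" "r \<notin> A" for A and f :: "nat \<Rightarrow> 'a"
  proof -
    have "({1..n} - {r}) \<inter> A = A"
      using that by auto
    then show ?thesis
      by (simp add: sum.inter_restrict[symmetric])
  qed
  have diff: "(\<Sum>s\<in>A. ?t A B s u v) = (?K A v - ?K A u) * ?K B u"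
    if "A \<subseteq> {1..n}" "r \<notin> A" "(u, v) \<in> distinct_pairs N" for A B u v
    using that r(1) by (subst fibre_sum_diff) (auto simp: distinct_pairs_def sum_distrib_right)
  have "(\<Sum>s\<in>{1..n} - {r}. \<Sum>(u, v)\<in>distinct_pairs N. ydiff z u v r * ydiff z u v s * ?T s u v) =
      (\<Sum>(u, v)\<in>distinct_pairs N. ydiff z u v r *
        (\<Sum>s\<in>{1..n} - {r}. ydiff z u v s * ?T s u v))"
    by (subst sum.swap) (simp add: sum_distrib_left mult.assoc case_prod_unfold)
  also have "\<dots> = (\<Sum>(u, v)\<in>distinct_pairs N.
      (z u r - z v r) * (?K R u * ?K S v - ?K S u * ?K R v))"
  proof (intro sum.cong refl, clarify)
    fix u v
    assume uv: "(u, v) \<in> distinct_pairs N"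
    have inner: "(\<Sum>s\<in>{1..n} - {r}. ydiff z u v s * ?T s u v) =
        (?K S v - ?K S u) * ?K R u - (?K R v - ?K R u) * ?K S u"
      unfolding T
      unfolding sum_subtractf restrict[OF assms(4) r(3)] restrict[OF assms(3) r(2)]
        diff[OF assms(4) r(3) uv] diff[OF assms(3) r(2) uv] ..
    show "ydiff z u v r * (\<Sum>s\<in>{1..n} - {r}. ydiff z u v s * ?T s u v) =
        (z u r - z v r) * (?K R u * ?K S v - ?K S u * ?K R v)"
      \<comment> \<open>The two terms \<open>?K R u * ?K S u\<close> cancel.\<close>
      unfolding inner by (simp add: ydiff_def algebra_simps)
  qed
  also have "\<dots> = (\<Sum>u\<in>{1..N}. \<Sum>v\<in>{1..N}.
      (z u r - z v r) * (?K R u * ?K S v - ?K S u * ?K R v))"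
    \<comment> \<open>The diagonal may be added since \<open>z u r - z v r\<close> vanishes
      there.\<close>
    by (rule sum_distinct_pairs) simp
  also have "\<dots> = ?D + ?D"
    unfolding sum_antisymmetrized Let_def pbar_insert_eq_sum_fibre_sum[OF r(1,2) fin(1)]
      pbar_insert_eq_sum_fibre_sum[OF r(1,3) fin(2)]
    \<comment> \<open>This comes second because it would also rewrite \<open>pbar\<close> at
      \<open>R \<union> {r}\<close> and \<open>S \<union> {r}\<close>.\<close>
    unfolding pbar_eq_sum_fibre_sum[OF r(1)] ..
  finally have "(\<Sum>s\<in>{1..n} - {r}. \<Sum>(u, v)\<in>distinct_pairs N.
      ydiff z u v r * ydiff z u v s * ?T s u v) = ?D + ?D" .
  \<comment> \<open>Halving happens among the rational scalars: 1/2 + 1/2 = 1.\<close>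
  moreover have "(1/2) *\<^sub>Q (?D + ?D) = ?D"
    unfolding scale_right_distrib scale_left_distrib[symmetric] by simp
  ultimately show ?thesis
    by simp
qed

end
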